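(* Fix $p>0$ and let $u^\star:\mathbb{R}^n\to\mathbb{R}^m$ be the $u$-component of the pointwise solution of the quadratic program $$\min_{(u,\delta)\in\mathbb{R}^{m+1}} \tfrac12\|u\|^2+\tfrac12 p\,\delta^2\quad\text{s.t.}\quad L_fV(x)+L_gV(x)u+\gamma(V(x))\le\delta,\qquad L_fh(x)+L_gh(x)u+\alpha(h(x))\ge 0 .$$ Then the set of equilibrium points of the closed-loop system $\dot x=f(x)+g(x)u^\star(x)$, i.e. $\{x\in\mathbb{R}^n: f(x)+g(x)u^\star(x)=0\}$, is given by $\mathscr{E}=\mathscr{E}^{clf}_{\overline{cbf}}\cup\mathscr{E}^{clf}_{cbf,1}\cup\mathscr{E}^{clf}_{cbf,2}$, where (all functions evaluated at $x$) $$\mathscr{E}^{clf}_{\overline{cbf}}=\{x\in\Omega^{clf}_{\overline{cbf}}\cap\mathrm{Int}(\mathscr{C}): f=p\,\gamma(V)\,g\,L_gV^\top\},$$ $$\mathscr{E}^{clf}_{cbf,1}=\{x\in\Omega^{clf}_{cbf,1}\cap\partial\mathscr{C}: f=p\,\gamma(V)\,g\,L_gV^\top\},$$ $$\mathscr{E}^{clf}_{cbf,2}=\{x\in\Omega^{clf}_{cbf,2}\cap\partial\mathscr{C}: f=\lambda_1\,g\,L_gV^\top-\lambda_2\,g\,L_gh^\top\},$$ with $$\lambda_1=\Delta^{-1}\big(F_V L_ghL_gh^\top-F_hL_gVL_gh^\top\big),\qquad \lambda_2=\Delta^{-1}\big(F_VL_gVL_gh^\top-F_h(1/p+L_gVL_gV^\top)\big),$$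 $$\Delta=(1/p+L_gVL_gV^\top)\,L_ghL_gh^\top-(L_gVL_gh^\top)^2 .$$
   Context: Setting: $\dot x=f(x)+g(x)u$, $x\in\mathbb{R}^n$, $u\in\mathbb{R}^m$, with $f:\mathbb{R}^n\to\mathbb{R}^n$ and $g:\mathbb{R}^n\to\mathbb{R}^{n\times m}$ locally Lipschitz. For a differentiable $\phi:\mathbb{R}^n\to\mathbb{R}$, $L_f\phi=\nabla\phi^\top f\in\mathbb{R}$ and $L_g\phi=\nabla\phi^\top g\in\mathbb{R}^{1\times m}$. $V:\mathbb{R}^n\to\mathbb{R}$ is a control Lyapunov function (CLF): $V$ is smooth and positive definite, and $\inf_{u\in\mathbb{R}^m}[L_fV(x)+L_gV(x)u]\le-\gamma(V(x))$ for all $x\in\mathbb{R}^n$, where $\gamma:\mathbb{R}_{\ge0}\to\mathbb{R}_{\ge0}$ is class $\mathcal{K}$ (continuous, strictly increasing, $\gamma(0)=0$). $h:\mathbb{R}^n\to\mathbb{R}$ is a control barrier function (CBF): $h$ is smooth and $\sup_{u\in\mathbb{R}^m}[L_fh(x)+L_gh(x)u+\alpha(h(x))]\ge0$ for all $x\in\mathbb{R}^n$, where $\alpha:\mathbb{R}\to\mathbb{R}$ is a locally Lipschitz extended class $\mathcal{K}$ function (continuous, strictly increasing, $\alpha(0)=0$). The safety set is $\mathscr{C}=\{x\in\mathbb{R}^n: h(x)\ge0\}$; $\mathrm{Int}(\mathscr{C})$ and $\partial\mathscr{C}$ denote its interior and boundary. The origin is in $\mathrm{Int}(\mathscr{C})$.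 These functions $\gamma,\alpha$ are the ones used in the quadratic program. Notation: $F_V=L_fV+\gamma(V)$, $F_h=L_fh+\alpha(h)$, and $\Omega^{clf}_{\overline{cbf}}=\{x: F_V\ge0,\ F_VL_ghL_gV^\top-F_h(1/p+L_gVL_gV^\top)<0\}$, $\Omega^{clf}_{cbf,1}=\{x: F_V\ge0,\ F_h=0,\ L_gh=0\}$, $\Omega^{clf}_{cbf,2}=\{x: F_VL_ghL_gh^\top-F_hL_gVL_gh^\top\ge0,\ F_VL_gVL_gh^\top-F_h(1/p+L_gVL_gV^\top)\ge0,\ L_gh\ne0\}$.
   Formalization: With topological Int(C) and ∂C the identity fails if h has a zero interior to C (e.g. h=(x-1)^2). Proved: the identity with Int(C)={h>0}, ∂C={h=0} in all cases, and with topological interior and boundary when every zero of h lies on ∂C. *)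

theory Defs
  imports "HOL-Analysis.Analysis"
begin

definition locally_lipschitz :: "('a::metric_space \<Rightarrow> 'b::metric_space) \<Rightarrow> bool" where
  "locally_lipschitz F \<longleftrightarrow> (\<forall>x. \<exists>r>0. \<exists>L. L-lipschitz_on (cball x r) F)"

definition partial_deriv :: "'n::finite \<Rightarrow> (real^'n \<Rightarrow> real) \<Rightarrow> real^'n \<Rightarrow> real" where
  "partial_deriv i \<phi> x = frechet_derivative \<phi> (at x) (axis i 1)"

definition grad :: "(real^'n \<Rightarrow> real) \<Rightarrow> real^'n \<Rightarrow> real^'n" where
  "grad \<phi> x = (\<chi> i. partial_deriv i \<phi> x)"

primrec C_k :: "nat \<Rightarrow> (real^'n \<Rightarrow> real) \<Rightarrow> bool" where
  "C_k 0 \<phi> \<longleftrightarrow> continuous_on UNIV \<phi>"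
| "C_k (Suc k) \<phi> \<longleftrightarrow>
     (\<forall>x. \<phi> differentiable (at x)) \<and> (\<forall>i. C_k k (partial_deriv i \<phi>))"

definition smooth :: "(real^'n \<Rightarrow> real) \<Rightarrow> bool" where
  "smooth \<phi> \<longleftrightarrow> (\<forall>k. C_k k \<phi>)"

definition Lie_f :: "(real^'n \<Rightarrow> real^'n) \<Rightarrow> (real^'n \<Rightarrow> real) \<Rightarrow> real^'n \<Rightarrow> real" where
  "Lie_f f \<phi> x = grad \<phi> x \<bullet> f x"

text \<open>Row vectors such as $L_g\phi$ and column vectors such as $u$ are both elements of
  \<^typ>\<open>real^'m\<close>, so the products $L_g\phi\,u$ and $L_g\phi\,L_g\psi^\top$ are inner products.\<close>

definition Lie_g :: "(real^'n \<Rightarrow> real^'m^'n) \<Rightarrow> (real^'n \<Rightarrow> real) \<Rightarrow> real^'n \<Rightarrow> real^'m" where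
  "Lie_g g \<phi> x = grad \<phi> x v* g x"

definition class_K :: "(real \<Rightarrow> real) \<Rightarrow> bool" where
  "class_K \<gamma> \<longleftrightarrow> continuous_on {0..} \<gamma> \<and> strict_mono_on {0..} \<gamma> \<and> \<gamma> 0 = 0"

definition extended_class_K :: "(real \<Rightarrow> real) \<Rightarrow> bool" where
  "extended_class_K \<alpha> \<longleftrightarrow> continuous_on UNIV \<alpha> \<and> strict_mono \<alpha> \<and> \<alpha> 0 = 0"

definition positive_definite :: "(real^'n \<Rightarrow> real) \<Rightarrow> bool" where
  "positive_definite V \<longleftrightarrow> V 0 = 0 \<and> (\<forall>x. x \<noteq> 0 \<longrightarrow> V x > 0)"

text \<open>The infimum and the supremum over the unbounded set of inputs may be infinite, hence they
  are taken in the extended reals.\<close>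

definition control_lyapunov_function ::
  "(real^'n \<Rightarrow> real^'n) \<Rightarrow> (real^'n \<Rightarrow> real^'m^'n) \<Rightarrow> (real \<Rightarrow> real) \<Rightarrow> (real^'n \<Rightarrow> real) \<Rightarrow> bool" where
  "control_lyapunov_function f g \<gamma> V \<longleftrightarrow>
     smooth V \<and> positive_definite V \<and> class_K \<gamma> \<and>
     (\<forall>x. (INF u. ereal (Lie_f f V x + Lie_g g V x \<bullet> u)) \<le> ereal (- \<gamma> (V x)))"

definition control_barrier_function ::
  "(real^'n \<Rightarrow> real^'n) \<Rightarrow> (real^'n \<Rightarrow> real^'m^'n) \<Rightarrow> (real \<Rightarrow> real) \<Rightarrow> (real^'n \<Rightarrow> real) \<Rightarrow> bool" where
  "control_barrier_function f g \<alpha> h \<longleftrightarrow>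
     smooth h \<and> extended_class_K \<alpha> \<and> locally_lipschitz \<alpha> \<and>
     (\<forall>x. (SUP u. ereal (Lie_f f h x + Lie_g g h x \<bullet> u + \<alpha> (h x))) \<ge> 0)"

definition safe_set :: "(real^'n \<Rightarrow> real) \<Rightarrow> (real^'n) set" where
  "safe_set h = {x. h x \<ge> 0}"

definition qp_cost :: "real \<Rightarrow> (real^'m) \<times> real \<Rightarrow> real" where
  "qp_cost p = (\<lambda>(u, \<delta>). 1/2 * (norm u)\<^sup>2 + 1/2 * p * \<delta>\<^sup>2)"

definition qp_feasible ::
  "(real^'n \<Rightarrow> real^'n) \<Rightarrow> (real^'n \<Rightarrow> real^'m^'n) \<Rightarrow> (real^'n \<Rightarrow> real) \<Rightarrow> (real \<Rightarrow> real) \<Rightarrow>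
   (real^'n \<Rightarrow> real) \<Rightarrow> (real \<Rightarrow> real) \<Rightarrow> real^'n \<Rightarrow> (real^'m) \<times> real \<Rightarrow> bool" where
  "qp_feasible f g V \<gamma> h \<alpha> x = (\<lambda>(u, \<delta>).
     Lie_f f V x + Lie_g g V x \<bullet> u + \<gamma> (V x) \<le> \<delta> \<and>
     Lie_f f h x + Lie_g g h x \<bullet> u + \<alpha> (h x) \<ge> 0)"

definition qp_control ::
  "(real^'n \<Rightarrow> real^'n) \<Rightarrow> (real^'n \<Rightarrow> real^'m^'n) \<Rightarrow> (real^'n \<Rightarrow> real) \<Rightarrow> (real \<Rightarrow> real) \<Rightarrow>
   (real^'n \<Rightarrow> real) \<Rightarrow> (real \<Rightarrow> real) \<Rightarrow> real \<Rightarrow> real^'n \<Rightarrow> real^'m" where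
  "qp_control f g V \<gamma> h \<alpha> p x = fst (arg_min (qp_cost p) (qp_feasible f g V \<gamma> h \<alpha> x))"

definition equilibria ::
  "(real^'n \<Rightarrow> real^'n) \<Rightarrow> (real^'n \<Rightarrow> real^'m^'n) \<Rightarrow> (real^'n \<Rightarrow> real^'m) \<Rightarrow> (real^'n) set" where
  "equilibria f g u = {x. f x + g x *v u x = 0}"

text \<open>\<open>F_fun f \<gamma> V\<close> is $F_V$ and \<open>F_fun f \<alpha> h\<close> is $F_h$.\<close>

definition F_fun ::
  "(real^'n \<Rightarrow> real^'n) \<Rightarrow> (real \<Rightarrow> real) \<Rightarrow> (real^'n \<Rightarrow> real) \<Rightarrow> real^'n \<Rightarrow> real" where
  "F_fun f \<kappa> \<phi> x = Lie_f f \<phi> x + \<kappa> (\<phi> x)"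

definition Omega_clf_nocbf ::
  "(real^'n \<Rightarrow> real^'n) \<Rightarrow> (real^'n \<Rightarrow> real^'m^'n) \<Rightarrow> (real^'n \<Rightarrow> real) \<Rightarrow> (real \<Rightarrow> real) \<Rightarrow>
   (real^'n \<Rightarrow> real) \<Rightarrow> (real \<Rightarrow> real) \<Rightarrow> real \<Rightarrow> (real^'n) set" where
  "Omega_clf_nocbf f g V \<gamma> h \<alpha> p = {x. F_fun f \<gamma> V x \<ge> 0 \<and>
     F_fun f \<gamma> V x * (Lie_g g h x \<bullet> Lie_g g V x)
       - F_fun f \<alpha> h x * (1/p + Lie_g g V x \<bullet> Lie_g g V x) < 0}"

definition Omega_clf_cbf_1 ::
  "(real^'n \<Rightarrow> real^'n) \<Rightarrow> (real^'n \<Rightarrow> real^'m^'n) \<Rightarrow> (real^'n \<Rightarrow> real) \<Rightarrow> (real \<Rightarrow> real) \<Rightarrow>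
   (real^'n \<Rightarrow> real) \<Rightarrow> (real \<Rightarrow> real) \<Rightarrow> (real^'n) set" where
  "Omega_clf_cbf_1 f g V \<gamma> h \<alpha> =
     {x. F_fun f \<gamma> V x \<ge> 0 \<and> F_fun f \<alpha> h x = 0 \<and> Lie_g g h x = 0}"

definition lambda_1_num ::
  "(real^'n \<Rightarrow> real^'n) \<Rightarrow> (real^'n \<Rightarrow> real^'m^'n) \<Rightarrow> (real^'n \<Rightarrow> real) \<Rightarrow> (real \<Rightarrow> real) \<Rightarrow>
   (real^'n \<Rightarrow> real) \<Rightarrow> (real \<Rightarrow> real) \<Rightarrow> real^'n \<Rightarrow> real" where
  "lambda_1_num f g V \<gamma> h \<alpha> x =
     F_fun f \<gamma> V x * (Lie_g g h x \<bullet> Lie_g g h x) - F_fun f \<alpha> h x * (Lie_g g V x \<bullet> Lie_g g h x)"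

definition lambda_2_num ::
  "(real^'n \<Rightarrow> real^'n) \<Rightarrow> (real^'n \<Rightarrow> real^'m^'n) \<Rightarrow> (real^'n \<Rightarrow> real) \<Rightarrow> (real \<Rightarrow> real) \<Rightarrow>
   (real^'n \<Rightarrow> real) \<Rightarrow> (real \<Rightarrow> real) \<Rightarrow> real \<Rightarrow> real^'n \<Rightarrow> real" where
  "lambda_2_num f g V \<gamma> h \<alpha> p x =
     F_fun f \<gamma> V x * (Lie_g g V x \<bullet> Lie_g g h x)
       - F_fun f \<alpha> h x * (1/p + Lie_g g V x \<bullet> Lie_g g V x)"

definition Omega_clf_cbf_2 ::
  "(real^'n \<Rightarrow> real^'n) \<Rightarrow> (real^'n \<Rightarrow> real^'m^'n) \<Rightarrow> (real^'n \<Rightarrow> real) \<Rightarrow> (real \<Rightarrow> real) \<Rightarrow>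
   (real^'n \<Rightarrow> real) \<Rightarrow> (real \<Rightarrow> real) \<Rightarrow> real \<Rightarrow> (real^'n) set" where
  "Omega_clf_cbf_2 f g V \<gamma> h \<alpha> p =
     {x. lambda_1_num f g V \<gamma> h \<alpha> x \<ge> 0 \<and> lambda_2_num f g V \<gamma> h \<alpha> p x \<ge> 0 \<and> Lie_g g h x \<noteq> 0}"

definition Delta ::
  "(real^'n \<Rightarrow> real^'m^'n) \<Rightarrow> (real^'n \<Rightarrow> real) \<Rightarrow> (real^'n \<Rightarrow> real) \<Rightarrow> real \<Rightarrow> real^'n \<Rightarrow> real" where
  "Delta g V h p x =
     (1/p + Lie_g g V x \<bullet> Lie_g g V x) * (Lie_g g h x \<bullet> Lie_g g h x)
       - (Lie_g g V x \<bullet> Lie_g g h x)\<^sup>2"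

definition lambda_1 ::
  "(real^'n \<Rightarrow> real^'n) \<Rightarrow> (real^'n \<Rightarrow> real^'m^'n) \<Rightarrow> (real^'n \<Rightarrow> real) \<Rightarrow> (real \<Rightarrow> real) \<Rightarrow>
   (real^'n \<Rightarrow> real) \<Rightarrow> (real \<Rightarrow> real) \<Rightarrow> real \<Rightarrow> real^'n \<Rightarrow> real" where
  "lambda_1 f g V \<gamma> h \<alpha> p x = inverse (Delta g V h p x) * lambda_1_num f g V \<gamma> h \<alpha> x"

definition lambda_2 ::
  "(real^'n \<Rightarrow> real^'n) \<Rightarrow> (real^'n \<Rightarrow> real^'m^'n) \<Rightarrow> (real^'n \<Rightarrow> real) \<Rightarrow> (real \<Rightarrow> real) \<Rightarrow>
   (real^'n \<Rightarrow> real) \<Rightarrow> (real \<Rightarrow> real) \<Rightarrow> real \<Rightarrow> real^'n \<Rightarrow> real" where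
  "lambda_2 f g V \<gamma> h \<alpha> p x = inverse (Delta g V h p x) * lambda_2_num f g V \<gamma> h \<alpha> p x"

text \<open>In the three families below, \<open>I\<close> and \<open>B\<close> stand for the interior and the boundary of the
  safe set. They are parameters because two conventions are in use: the topological
  \<open>interior\<close> and \<open>frontier\<close>, and the level sets $\{h > 0\}$ and $\{h = 0\}$. The conventions
  agree when every zero of $h$ is a topological boundary point of $\{h \ge 0\}$, and may differ
  otherwise, e.g. at a local minimum of $h$ with value $0$.\<close>

definition E_clf_nocbf ::
  "(real^'n \<Rightarrow> real^'n) \<Rightarrow> (real^'n \<Rightarrow> real^'m^'n) \<Rightarrow> (real^'n \<Rightarrow> real) \<Rightarrow> (real \<Rightarrow> real) \<Rightarrow>
   (real^'n \<Rightarrow> real) \<Rightarrow> (real \<Rightarrow> real) \<Rightarrow> real \<Rightarrow> (real^'n) set \<Rightarrow> (real^'n) set" where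
  "E_clf_nocbf f g V \<gamma> h \<alpha> p I =
     {x \<in> Omega_clf_nocbf f g V \<gamma> h \<alpha> p \<inter> I. f x = (p * \<gamma> (V x)) *\<^sub>R (g x *v Lie_g g V x)}"

definition E_clf_cbf_1 ::
  "(real^'n \<Rightarrow> real^'n) \<Rightarrow> (real^'n \<Rightarrow> real^'m^'n) \<Rightarrow> (real^'n \<Rightarrow> real) \<Rightarrow> (real \<Rightarrow> real) \<Rightarrow>
   (real^'n \<Rightarrow> real) \<Rightarrow> (real \<Rightarrow> real) \<Rightarrow> real \<Rightarrow> (real^'n) set \<Rightarrow> (real^'n) set" where
  "E_clf_cbf_1 f g V \<gamma> h \<alpha> p B =
     {x \<in> Omega_clf_cbf_1 f g V \<gamma> h \<alpha> \<inter> B. f x = (p * \<gamma> (V x)) *\<^sub>R (g x *v Lie_g g V x)}"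

definition E_clf_cbf_2 ::
  "(real^'n \<Rightarrow> real^'n) \<Rightarrow> (real^'n \<Rightarrow> real^'m^'n) \<Rightarrow> (real^'n \<Rightarrow> real) \<Rightarrow> (real \<Rightarrow> real) \<Rightarrow>
   (real^'n \<Rightarrow> real) \<Rightarrow> (real \<Rightarrow> real) \<Rightarrow> real \<Rightarrow> (real^'n) set \<Rightarrow> (real^'n) set" where
  "E_clf_cbf_2 f g V \<gamma> h \<alpha> p B =
     {x \<in> Omega_clf_cbf_2 f g V \<gamma> h \<alpha> p \<inter> B.
        f x = lambda_1 f g V \<gamma> h \<alpha> p x *\<^sub>R (g x *v Lie_g g V x)
            - lambda_2 f g V \<gamma> h \<alpha> p x *\<^sub>R (g x *v Lie_g g h x)}"

end

theory Submission
  imports Defs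
begin

text \<open>The quadratic program is strictly convex, so its solution at \<open>x\<close> is the unique point with
  Karush--Kuhn--Tucker multipliers \<open>l\<^sub>1, l\<^sub>2\<close>, namely $u = l_2 L_gh^\top - l_1 L_gV^\top$ and
  $\delta = l_1/p$. At an equilibrium the chain rule gives $F_V + L_gV u = \gamma(V)$ and
  $F_h + L_gh u = \alpha(h)$. Complementary slackness for the first constraint then forces
  $l_1 = p\gamma(V)$, and the second constraint is active exactly when $h = 0$. The three families
  correspond to $h > 0$, to $h = 0$ with $L_gh = 0$, and to $h = 0$ with $L_gh \neq 0$; in the last
  case the multipliers solve a linear system with determinant $\Delta > 0$.\<close>

section \<open>Multipliers of an abstract program with two affine constraints\<close>

text \<open>Stationarity is built in: it expresses the control as \<open>u\<close> and the slack as
  \<open>l1 / p\<close>. What remains is signs, feasibility and complementary slackness.\<close>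

definition kkt_multipliers ::
  "real \<Rightarrow> 'a::real_inner \<Rightarrow> 'a \<Rightarrow> real \<Rightarrow> real \<Rightarrow> real \<Rightarrow> real \<Rightarrow> bool" where
  "kkt_multipliers p a b F H l1 l2 \<longleftrightarrow>
     (let u = l2 *\<^sub>R b - l1 *\<^sub>R a in
       l1 \<ge> 0 \<and> l2 \<ge> 0 \<and>
       F + a \<bullet> u \<le> l1 / p \<and> H + b \<bullet> u \<ge> 0 \<and>
       l1 * (F + a \<bullet> u - l1 / p) = 0 \<and> l2 * (H + b \<bullet> u) = 0)"

text \<open>Expand twice the cost around \<open>(u0, l1 / p)\<close>: half its linear term is
  \<open>u0 \<bullet> (u - u0) + l1 * (d - l1 / p)\<close>, which is nonnegative by complementary
  slackness and the multiplier signs. Keeping the squared distances yields optimality and uniqueness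
  together.\<close>

lemma kkt_cost_gap:
  fixes a b u :: "'a::real_inner"
  assumes kkt: "kkt_multipliers p a b F H l1 l2" and p: "0 < p"
    and u0: "u0 = l2 *\<^sub>R b - l1 *\<^sub>R a"
    and feas: "F + a \<bullet> u \<le> d" "H + b \<bullet> u \<ge> 0"
  shows "(norm u0)\<^sup>2 + p * (l1 / p)\<^sup>2 + (norm (u - u0))\<^sup>2 + p * (d - l1 / p)\<^sup>2
         \<le> (norm u)\<^sup>2 + p * d\<^sup>2"
proof -
  have slack: "l1 * (F + a \<bullet> u0 - l1 / p) = 0" "l2 * (H + b \<bullet> u0) = 0" and "l1 \<ge> 0" "l2 \<ge> 0"
    using kkt by (auto simp: kkt_multipliers_def Let_def u0)
  have "l1 * (F + a \<bullet> u - d) \<le> 0" "l2 * (H + b \<bullet> u) \<ge> 0"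
    using feas \<open>l1 \<ge> 0\<close> \<open>l2 \<ge> 0\<close> by (auto simp: mult_nonneg_nonpos)
  moreover have "u0 \<bullet> (u - u0) = l2 * (b \<bullet> u - b \<bullet> u0) - l1 * (a \<bullet> u - a \<bullet> u0)"
    unfolding u0 by (simp add: inner_diff_left inner_diff_right algebra_simps)
  ultimately have "u0 \<bullet> (u - u0) + l1 * (d - l1 / p) \<ge> 0"
    using slack by (simp add: algebra_simps)
  moreover have "(norm u)\<^sup>2 = (norm u0)\<^sup>2 + (norm (u - u0))\<^sup>2 + 2 * (u0 \<bullet> (u - u0))"
    by (simp add: power2_norm_eq_inner inner_diff_left inner_diff_right inner_commute)
  moreover have "p * d\<^sup>2 = p * (l1 / p)\<^sup>2 + p * (d - l1 / p)\<^sup>2 + 2 * (l1 * (d - l1 / p))"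
    using p by (simp add: power2_eq_square field_simps)
  ultimately show ?thesis by linarith
qed

text \<open>The term \<open>1 / p\<close>, coming from the penalty on the slack, makes
  Cauchy-Schwarz strict even for parallel \<open>a\<close> and \<open>b\<close>.\<close>

lemma gram_determinant_pos:
  fixes a b :: "'a::real_inner"
  assumes "0 < p" "b \<noteq> 0"
  shows "(a \<bullet> b)\<^sup>2 < (1 / p + a \<bullet> a) * (b \<bullet> b)"
proof -
  have "(a \<bullet> b)\<^sup>2 \<le> (a \<bullet> a) * (b \<bullet> b)"
    by (rule Cauchy_Schwarz_ineq)
  moreover have "1 / p * (b \<bullet> b) > 0"
    using assms by simp
  ultimately show ?thesis by (simp add: distrib_right)
qed

lemma cramer_2x2:
  fixes A B C F H l1 l2 :: real
  assumes "C\<^sup>2 < A * B"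
  shows "F + l2 * C - l1 * A = 0 \<and> H + l2 * B - l1 * C = 0 \<longleftrightarrow>
    l1 = (F * B - H * C) / (A * B - C\<^sup>2) \<and> l2 = (F * C - H * A) / (A * B - C\<^sup>2)"
proof -
  define D where "D = A * B - C\<^sup>2"
  have D: "D > 0" using assms by (simp add: D_def)
  have "F + l2 * C - l1 * A = 0 \<and> H + l2 * B - l1 * C = 0 \<longleftrightarrow>
      D * l1 = F * B - H * C \<and> D * l2 = F * C - H * A"
  proof
    assume "F + l2 * C - l1 * A = 0 \<and> H + l2 * B - l1 * C = 0"
    then have F: "F = l1 * A - l2 * C" and H: "H = l1 * C - l2 * B" by auto
    show "D * l1 = F * B - H * C \<and> D * l2 = F * C - H * A"
      unfolding D_def F H by (simp add: power2_eq_square algebra_simps)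
  next
    assume *: "D * l1 = F * B - H * C \<and> D * l2 = F * C - H * A"
    have "D * (F + l2 * C - l1 * A) = D * F + (D * l2) * C - (D * l1) * A"
      "D * (H + l2 * B - l1 * C) = D * H + (D * l2) * B - (D * l1) * C"
      by (simp_all add: algebra_simps)
    then have "D * (F + l2 * C - l1 * A) = 0" "D * (H + l2 * B - l1 * C) = 0"
      unfolding conjunct1[OF *] conjunct2[OF *] by (simp_all add: D_def power2_eq_square algebra_simps)
    with D show "F + l2 * C - l1 * A = 0 \<and> H + l2 * B - l1 * C = 0" by simp
  qed
  then show ?thesis
    using D unfolding D_def[symmetric] by (simp add: eq_divide_eq mult.commute)
qed

text \<open>One explicit candidate is given for each set of active constraints; the signs of
  \<open>F\<close>, \<open>H\<close> and the two Cramer numerators decide which one is valid. For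
  \<open>b = 0\<close> the second constraint reads \<open>H \<ge> 0\<close>, which
  \<open>feasible\<close> supplies.\<close>

lemma kkt_multipliers_exist:
  fixes a b :: "'a::real_inner"
  assumes p: "0 < p" and feasible: "b = 0 \<Longrightarrow> H \<ge> 0"
  shows "\<exists>l1 l2. kkt_multipliers p a b F H l1 l2"
proof -
  define A B C where "A = 1 / p + a \<bullet> a" and "B = b \<bullet> b" and "C = a \<bullet> b"
  note kkt_simps = kkt_multipliers_def Let_def inner_diff_right
  have A: "A > 0" using p by (simp add: A_def add_pos_nonneg)
  have aa: "a \<bullet> a = A - 1 / p" by (simp add: A_def)
  have dots: "b \<bullet> b = B" "a \<bullet> b = C" "b \<bullet> a = C"
    by (simp_all add: B_def C_def inner_commute)
  have inactive: "kkt_multipliers p a b F H 0 0" if "F \<le> 0" "H \<ge> 0"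
    using that by (simp add: kkt_simps)
  \<comment> \<open>With \<open>l2 = 0\<close>, activity of the first constraint means
    \<open>F - l1 * (a \<bullet> a) = l1 / p\<close>, so \<open>l1 = F / A\<close>.\<close>
  have clf: "kkt_multipliers p a b F H (F / A) 0" if "F \<ge> 0" "F * C - H * A \<le> 0"
    using that A p by (simp add: kkt_simps aa dots field_simps)
  show ?thesis
  proof (cases "b = 0")
    case True
    then show ?thesis
      using inactive clf feasible A by (cases "F \<le> 0") (auto simp: C_def)
  next
    case False
    have B: "B > 0" using False by (simp add: B_def)
    have det: "C\<^sup>2 < A * B"
      using gram_determinant_pos[OF p False, of a] by (simp add: A_def B_def C_def)
    \<comment> \<open>With \<open>l1 = 0\<close>, activity of the second constraint means
      \<open>H + l2 * B = 0\<close>.\<close>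
    have cbf: "kkt_multipliers p a b F H 0 (- H / B)" if "H \<le> 0" "F * B - H * C \<le> 0"
      using that B by (simp add: kkt_simps dots field_simps)
    have both: "kkt_multipliers p a b F H ((F * B - H * C) / (A * B - C\<^sup>2))
        ((F * C - H * A) / (A * B - C\<^sup>2))"
      if "F * B - H * C \<ge> 0" "F * C - H * A \<ge> 0"
    proof -
      define D l1 l2 where "D = A * B - C\<^sup>2"
        and "l1 = (F * B - H * C) / D" and "l2 = (F * C - H * A) / D"
      have D: "D > 0" using det by (simp add: D_def)
      have "F + l2 * C - l1 * A = 0" "H + l2 * B - l1 * C = 0"
        using cramer_2x2[OF det, of F l2 l1 H] by (simp_all add: l1_def l2_def D_def)
      then have "F + a \<bullet> (l2 *\<^sub>R b - l1 *\<^sub>R a) = l1 / p" "H + b \<bullet> (l2 *\<^sub>R b - l1 *\<^sub>R a) = 0"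
        by (simp_all add: inner_diff_right aa dots right_diff_distrib)
      moreover have "l1 \<ge> 0" "l2 \<ge> 0"
        using D that by (simp_all add: l1_def l2_def)
      ultimately have "kkt_multipliers p a b F H l1 l2"
        by (simp add: kkt_multipliers_def Let_def)
      then show ?thesis by (simp add: l1_def l2_def D_def)
    qed
    \<comment> \<open>Both sign patterns not covered by the four candidates contradict the determinant bound.\<close>
    have no1: False if "F \<ge> 0" "H > 0" "F * C - H * A \<ge> 0" "F * B - H * C < 0"
    proof -
      have "F * C > 0"
        using that A mult_pos_pos[of H A] by linarith
      with that have "F > 0" "C > 0"
        by (auto simp: zero_less_mult_iff)
      \<comment> \<open>Scaling one sign condition by \<open>A\<close> and the other by
        \<open>C\<close> eliminates \<open>H\<close>.\<close>
      have "F * B * A < H * C * A"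
        using that A by simp
      also have "\<dots> \<le> F * C * C"
        using mult_right_mono[of "H * A" "F * C" C] that \<open>C > 0\<close> by (simp add: algebra_simps)
      finally have "F * (A * B) < F * C\<^sup>2"
        by (simp add: power2_eq_square algebra_simps)
      with \<open>F > 0\<close> det show False by simp
    qed
    have no2: False if "F < 0" "H < 0" "F * B - H * C \<ge> 0" "F * C - H * A < 0"
    proof -
      have "F * C < 0"
        using that A mult_neg_pos[of H A] by linarith
      with that have "C > 0"
        by (auto simp: mult_less_0_iff)
      have "F * C * C < H * A * C"
        using that \<open>C > 0\<close> by simp
      also have "\<dots> \<le> F * B * A"
        using mult_right_mono[of "H * C" "F * B" A] that A by (simp add: algebra_simps)
      finally have "F * C\<^sup>2 < F * (A * B)"
        by (simp add: power2_eq_square algebra_simps)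
      with \<open>F < 0\<close> det show False by simp
    qed
    show ?thesis
      using inactive clf cbf both no1 no2 by (meson le_cases not_le)
  qed
qed

section \<open>The feedback of the quadratic program and its equilibria through multipliers\<close>

lemma inner_Lie_g: "Lie_g g \<phi> x \<bullet> u = grad \<phi> x \<bullet> (g x *v u)"
  by (simp add: Lie_g_def dot_lmul_matrix)

text \<open>\<open>arg_min\<close> is a choice operator, so exhibiting a minimiser is not enough:
  the distance term in the cost gap shows that every minimiser has the same
  \<open>u\<close>.\<close>

lemma qp_control_eqI:
  fixes f :: "real^'n \<Rightarrow> real^'n" and g :: "real^'n \<Rightarrow> real^'m^'n"
  assumes p: "0 < p"
    and kkt: "kkt_multipliers p (Lie_g g V x) (Lie_g g h x) (F_fun f \<gamma> V x) (F_fun f \<alpha> h x) l1 l2"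
  shows "qp_control f g V \<gamma> h \<alpha> p x = l2 *\<^sub>R Lie_g g h x - l1 *\<^sub>R Lie_g g V x"
proof -
  define u0 where "u0 = l2 *\<^sub>R Lie_g g h x - l1 *\<^sub>R Lie_g g V x"
  have feas0: "qp_feasible f g V \<gamma> h \<alpha> x (u0, l1 / p)"
    using kkt by (simp add: qp_feasible_def kkt_multipliers_def Let_def u0_def F_fun_def algebra_simps)
  have gap: "qp_cost p (u0, l1 / p) + (norm (u - u0))\<^sup>2 / 2 + p * (d - l1 / p)\<^sup>2 / 2 \<le> qp_cost p (u, d)"
    if "qp_feasible f g V \<gamma> h \<alpha> x (u, d)" for u d
  proof -
    have "F_fun f \<gamma> V x + Lie_g g V x \<bullet> u \<le> d" "F_fun f \<alpha> h x + Lie_g g h x \<bullet> u \<ge> 0"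
      using that by (simp_all add: qp_feasible_def F_fun_def algebra_simps)
    from kkt_cost_gap[OF kkt p u0_def this] show ?thesis
      by (simp add: qp_cost_def)
  qed
  have nonneg: "(norm (u - u0))\<^sup>2 / 2 \<ge> 0" "p * (d - l1 / p)\<^sup>2 / 2 \<ge> 0" for u d
    using p by simp_all
  have "is_arg_min (qp_cost p) (qp_feasible f g V \<gamma> h \<alpha> x) (u0, l1 / p)"
    unfolding is_arg_min_linorder
  proof (intro conjI allI impI)
    fix y assume "qp_feasible f g V \<gamma> h \<alpha> x y"
    then have "qp_feasible f g V \<gamma> h \<alpha> x (fst y, snd y)" by simp
    from gap[OF this] nonneg(1)[of "fst y"] nonneg(2)[of "snd y"]
    show "qp_cost p (u0, l1 / p) \<le> qp_cost p y"
      unfolding prod.collapse by linarith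
  qed (fact feas0)
  moreover define m where "m = arg_min (qp_cost p) (qp_feasible f g V \<gamma> h \<alpha> x)"
  ultimately have "is_arg_min (qp_cost p) (qp_feasible f g V \<gamma> h \<alpha> x) m"
    unfolding m_def arg_min_def by (metis someI)
  then have "qp_feasible f g V \<gamma> h \<alpha> x m" "qp_cost p m \<le> qp_cost p (u0, l1 / p)"
    using feas0 by (auto simp: is_arg_min_linorder)
  then have "(norm (fst m - u0))\<^sup>2 / 2 \<le> 0"
    using gap[of "fst m" "snd m"] nonneg(2)[of "snd m"] unfolding prod.collapse by linarith
  then have "fst m = u0" by simp
  then show ?thesis by (simp add: qp_control_def m_def u0_def)
qed

text \<open>When \<open>Lie_g g h x = 0\<close>, the expression under the supremum is constant in
  \<open>u\<close>. This secures feasibility where no input can influence the barrier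
  constraint.\<close>

lemma control_barrier_function_F_nonneg:
  assumes "control_barrier_function f g \<alpha> h" "Lie_g g h x = 0"
  shows "F_fun f \<alpha> h x \<ge> 0"
proof -
  have "0 \<le> (SUP u. ereal (Lie_f f h x + Lie_g g h x \<bullet> u + \<alpha> (h x)))"
    using assms(1) by (auto simp: control_barrier_function_def)
  then show ?thesis using assms(2) by (simp add: F_fun_def)
qed

text \<open>All multiplier pairs represent the same control, so the equation for any one pair
  decides membership; existence of a pair then removes \<open>arg_min\<close> from the
  condition.\<close>

lemma equilibria_qp_control_iff:
  assumes p: "0 < p" and cbf: "control_barrier_function f g \<alpha> h"
  shows "x \<in> equilibria f g (qp_control f g V \<gamma> h \<alpha> p) \<longleftrightarrow>
    (\<exists>l1 l2. kkt_multipliers p (Lie_g g V x) (Lie_g g h x) (F_fun f \<gamma> V x) (F_fun f \<alpha> h x) l1 l2 \<and>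
      f x = l1 *\<^sub>R (g x *v Lie_g g V x) - l2 *\<^sub>R (g x *v Lie_g g h x))"
    (is "_ \<longleftrightarrow> (\<exists>l1 l2. ?kkt l1 l2 \<and> _)")
proof -
  have eq: "x \<in> equilibria f g (qp_control f g V \<gamma> h \<alpha> p) \<longleftrightarrow>
      f x = l1 *\<^sub>R (g x *v Lie_g g V x) - l2 *\<^sub>R (g x *v Lie_g g h x)" if "?kkt l1 l2" for l1 l2
    using qp_control_eqI[OF p that]
    by (simp add: equilibria_def matrix_vector_mult_diff_distrib matrix_vector_mult_scaleR
        add_eq_0_iff2)
  obtain l1 l2 where "?kkt l1 l2"
    using kkt_multipliers_exist[OF p control_barrier_function_F_nonneg[OF cbf]] by blast
  then show ?thesis using eq by blast
qed

section \<open>Explicit multipliers and the level-set description\<close>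

lemma Delta_pos: "0 < p \<Longrightarrow> Lie_g g h x \<noteq> 0 \<Longrightarrow> 0 < Delta g V h p x"
  using gram_determinant_pos[of p "Lie_g g h x" "Lie_g g V x"] by (simp add: Delta_def)

lemma lambda_solution_iff:
  assumes p: "0 < p" and b: "Lie_g g h x \<noteq> 0"
  shows "F_fun f \<gamma> V x + Lie_g g V x \<bullet> (l2 *\<^sub>R Lie_g g h x - l1 *\<^sub>R Lie_g g V x) = l1 / p \<and>
      F_fun f \<alpha> h x + Lie_g g h x \<bullet> (l2 *\<^sub>R Lie_g g h x - l1 *\<^sub>R Lie_g g V x) = 0 \<longleftrightarrow>
    l1 = lambda_1 f g V \<gamma> h \<alpha> p x \<and> l2 = lambda_2 f g V \<gamma> h \<alpha> p x"
proof -
  define A B C where "A = 1 / p + Lie_g g V x \<bullet> Lie_g g V x"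
    and "B = Lie_g g h x \<bullet> Lie_g g h x" and "C = Lie_g g V x \<bullet> Lie_g g h x"
  define F H D where "F = F_fun f \<gamma> V x" and "H = F_fun f \<alpha> h x" and "D = A * B - C\<^sup>2"
  have D: "D > 0"
    using Delta_pos[where g=g and h=h and x=x and V=V, OF p b] by (simp add: Delta_def A_def B_def C_def D_def)
  have dots: "Lie_g g h x \<bullet> Lie_g g h x = B" "Lie_g g V x \<bullet> Lie_g g h x = C"
    "Lie_g g h x \<bullet> Lie_g g V x = C" "Lie_g g V x \<bullet> Lie_g g V x = A - 1 / p"
    by (simp_all add: A_def B_def C_def inner_commute)
  have lambda: "lambda_1 f g V \<gamma> h \<alpha> p x = (F * B - H * C) / D"
    "lambda_2 f g V \<gamma> h \<alpha> p x = (F * C - H * A) / D"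
    by (simp_all add: lambda_1_def lambda_2_def lambda_1_num_def lambda_2_num_def Delta_def
        dots F_def H_def D_def field_simps)
  \<comment> \<open>Moving the slack \<open>l1 / p\<close> to the left completes
    \<open>A - 1 / p\<close> to \<open>A\<close>, as in Cramer's system.\<close>
  have "F + (l2 * C - l1 * (A - 1 / p)) = l1 / p \<longleftrightarrow> F + l2 * C - l1 * A = 0"
    "H + (l2 * B - l1 * C) = 0 \<longleftrightarrow> H + l2 * B - l1 * C = 0"
    by (auto simp: right_diff_distrib)
  then show ?thesis
    using cramer_2x2[of C A B F l2 l1 H] D
    by (simp add: lambda F_def[symmetric] H_def[symmetric] inner_diff_right dots D_def)
qed

lemma equilibria_qp_control_level_sets:
  assumes p: "0 < p" and clf: "control_lyapunov_function f g \<gamma> V"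
    and cbf: "control_barrier_function f g \<alpha> h"
  shows "equilibria f g (qp_control f g V \<gamma> h \<alpha> p) =
       E_clf_nocbf f g V \<gamma> h \<alpha> p {x. h x > 0} \<union>
       E_clf_cbf_1 f g V \<gamma> h \<alpha> p {x. h x = 0} \<union>
       E_clf_cbf_2 f g V \<gamma> h \<alpha> p {x. h x = 0}" (is "?L = ?E0 \<union> ?E1 \<union> ?E2")
proof (rule set_eqI)
  fix x
  define a b where "a = Lie_g g V x" and "b = Lie_g g h x"
  define F H where "F = F_fun f \<gamma> V x" and "H = F_fun f \<alpha> h x"
  define A where "A = 1 / p + a \<bullet> a"
  have A: "A > 0" using p by (simp add: A_def add_pos_nonneg)
  have V: "V x \<ge> 0"
    using clf by (cases "x = 0") (auto simp: control_lyapunov_function_def positive_definite_def less_imp_le)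
  have "\<gamma> 0 = 0" and mono: "strict_mono_on {0..} \<gamma>"
    using clf by (auto simp: control_lyapunov_function_def class_K_def)
  then have \<gamma>: "\<gamma> (V x) \<ge> 0"
    using V strict_mono_onD[OF mono, of 0 "V x"] by (cases "V x = 0") auto
  have "strict_mono \<alpha>" "\<alpha> 0 = 0"
    using cbf by (auto simp: control_barrier_function_def extended_class_K_def)
  then have \<alpha>: "\<alpha> (h x) > 0 \<longleftrightarrow> h x > 0" "\<alpha> (h x) \<ge> 0 \<longleftrightarrow> h x \<ge> 0"
    by (metis strict_mono_less, metis strict_mono_less_eq)
  have iff: "x \<in> ?L \<longleftrightarrow> (\<exists>l1 l2. kkt_multipliers p a b F H l1 l2 \<and> f x = l1 *\<^sub>R (g x *v a) - l2 *\<^sub>R (g x *v b))"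
    unfolding a_def b_def F_def H_def by (rule equilibria_qp_control_iff[OF p cbf])
  \<comment> \<open>Here f + g u = 0, and the Lie derivative terms add up to a gradient paired with
    this zero vector.\<close>
  have closed_loop: "F + a \<bullet> (l2 *\<^sub>R b - l1 *\<^sub>R a) = \<gamma> (V x)" "H + b \<bullet> (l2 *\<^sub>R b - l1 *\<^sub>R a) = \<alpha> (h x)"
    if "f x = l1 *\<^sub>R (g x *v a) - l2 *\<^sub>R (g x *v b)" for l1 l2
    unfolding F_def H_def a_def b_def F_fun_def Lie_f_def inner_Lie_g that[unfolded a_def b_def]
    by (simp_all add: matrix_vector_mult_diff_distrib matrix_vector_mult_scaleR inner_diff_right)
  show "x \<in> ?L \<longleftrightarrow> x \<in> ?E0 \<union> ?E1 \<union> ?E2"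
  proof
    assume "x \<in> ?L"
    then obtain l1 l2 where kkt: "kkt_multipliers p a b F H l1 l2"
      and fx: "f x = l1 *\<^sub>R (g x *v a) - l2 *\<^sub>R (g x *v b)"
      unfolding iff by blast
    note cl = closed_loop[OF fx]
    have l: "l1 \<ge> 0" "l2 \<ge> 0" and "\<gamma> (V x) \<le> l1 / p" "\<alpha> (h x) \<ge> 0"
      and "l1 * (\<gamma> (V x) - l1 / p) = 0" and l2: "l2 * \<alpha> (h x) = 0"
      using kkt by (auto simp: kkt_multipliers_def Let_def cl)
    \<comment> \<open>If \<open>l1 = 0\<close>, then \<open>\<gamma> (V x)\<close> lies between 0
      and 0; otherwise slackness gives the equality.\<close>
    then have \<gamma>_eq: "\<gamma> (V x) = l1 / p" using \<gamma> by auto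
    then have l1: "l1 = p * \<gamma> (V x)" using p by simp
    \<comment> \<open>Solving the closed-loop identities for \<open>F\<close> and \<open>H\<close>
      reduces the sign conditions of the first two regions to signs of \<open>l1\<close> and
      \<open>\<alpha> (h x)\<close>.\<close>
    have Feq: "F = l1 * A - l2 * (a \<bullet> b)"
      using cl(1) \<gamma>_eq by (simp add: A_def inner_diff_right algebra_simps)
    have Heq: "H = \<alpha> (h x) + l1 * (a \<bullet> b) - l2 * (b \<bullet> b)"
      using cl(2) by (simp add: inner_diff_right inner_commute algebra_simps)
    have "h x \<ge> 0" using \<alpha> \<open>\<alpha> (h x) \<ge> 0\<close> by simp
    then consider "h x > 0" | "h x = 0" "b = 0" | "h x = 0" "b \<noteq> 0" by linarith
    then show "x \<in> ?E0 \<union> ?E1 \<union> ?E2"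
    proof cases
      case 1
      then have \<alpha>pos: "\<alpha> (h x) > 0" using \<alpha> by simp
      with l2 have "l2 = 0" by simp
      have "F * (b \<bullet> a) - H * A = - \<alpha> (h x) * A"
        using \<open>l2 = 0\<close> by (simp add: Feq Heq inner_commute algebra_simps)
      also have "\<dots> < 0" using \<alpha>pos A by simp
      finally have "x \<in> Omega_clf_nocbf f g V \<gamma> h \<alpha> p"
        using Feq l A \<open>l2 = 0\<close> by (simp add: Omega_clf_nocbf_def F_def H_def a_def b_def A_def)
      then have "x \<in> ?E0"
        using 1 fx l1 \<open>l2 = 0\<close> by (simp add: E_clf_nocbf_def a_def)
      then show ?thesis by simp
    next
      case 2
      then have "x \<in> Omega_clf_cbf_1 f g V \<gamma> h \<alpha>"
        using Feq Heq l A \<open>\<alpha> 0 = 0\<close> by (simp add: Omega_clf_cbf_1_def F_def H_def b_def)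
      then have "x \<in> ?E1"
        using 2 fx l1 by (simp add: E_clf_cbf_1_def a_def)
      then show ?thesis by simp
    next
      case 3
      have b: "Lie_g g h x \<noteq> 0" using 3 by (simp add: b_def)
      have "l1 = lambda_1 f g V \<gamma> h \<alpha> p x \<and> l2 = lambda_2 f g V \<gamma> h \<alpha> p x"
        using lambda_solution_iff[OF p b] cl \<gamma>_eq 3 \<open>\<alpha> 0 = 0\<close>
        unfolding a_def b_def F_def H_def by metis
      moreover from this have "lambda_1_num f g V \<gamma> h \<alpha> x \<ge> 0" "lambda_2_num f g V \<gamma> h \<alpha> p x \<ge> 0"
        using l Delta_pos[OF p b, of V]
        by (auto simp: lambda_1_def lambda_2_def zero_le_mult_iff)
      ultimately have "x \<in> ?E2"
        using 3 fx by (simp add: E_clf_cbf_2_def Omega_clf_cbf_2_def a_def b_def)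
      then show ?thesis by simp
    qed
  next
    \<comment> \<open>This serves the first two families at once: the multipliers
      \<open>p * \<gamma> (V x)\<close> and \<open>0\<close> make the first constraint active and
      leave \<open>\<alpha> (h x) \<ge> 0\<close> as the second.\<close>
    have clf_active: "x \<in> ?L"
      if fx: "f x = (p * \<gamma> (V x)) *\<^sub>R (g x *v a)" and h: "h x \<ge> 0"
    proof -
      define l1 where "l1 = p * \<gamma> (V x)"
      have fx': "f x = l1 *\<^sub>R (g x *v a) - 0 *\<^sub>R (g x *v b)"
        using fx by (simp add: l1_def)
      note cl = closed_loop[OF this]
      have "kkt_multipliers p a b F H l1 0"
        unfolding kkt_multipliers_def Let_def cl using p \<gamma> \<alpha> h by (simp add: l1_def)
      then show ?thesis using fx' iff by blast
    qed
    assume "x \<in> ?E0 \<union> ?E1 \<union> ?E2"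
    then consider "x \<in> ?E0 \<union> ?E1" | "x \<in> ?E2" by blast
    then show "x \<in> ?L"
    proof cases
      case 1
      then show ?thesis
        using clf_active by (auto simp: E_clf_nocbf_def E_clf_cbf_1_def a_def)
    next
      case 2
      define l1 l2 where "l1 = lambda_1 f g V \<gamma> h \<alpha> p x" and "l2 = lambda_2 f g V \<gamma> h \<alpha> p x"
      have b: "Lie_g g h x \<noteq> 0" and nonneg: "lambda_1_num f g V \<gamma> h \<alpha> x \<ge> 0" "lambda_2_num f g V \<gamma> h \<alpha> p x \<ge> 0"
        and fx: "f x = l1 *\<^sub>R (g x *v a) - l2 *\<^sub>R (g x *v b)"
        using 2 by (auto simp: E_clf_cbf_2_def Omega_clf_cbf_2_def l1_def l2_def a_def b_def)
      have "l1 \<ge> 0" "l2 \<ge> 0"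
        using nonneg Delta_pos[OF p b, of V] by (simp_all add: l1_def l2_def lambda_1_def lambda_2_def)
      moreover have "F + a \<bullet> (l2 *\<^sub>R b - l1 *\<^sub>R a) = l1 / p \<and> H + b \<bullet> (l2 *\<^sub>R b - l1 *\<^sub>R a) = 0"
        unfolding a_def b_def F_def H_def
        using lambda_solution_iff[OF p b] l1_def l2_def by blast
      ultimately have "kkt_multipliers p a b F H l1 l2"
        by (simp add: kkt_multipliers_def Let_def)
      then show ?thesis using fx iff by blast
    qed
  qed
qed

section \<open>Interior and boundary of the safe set\<close>

text \<open>Continuity makes \<open>{x. h x > 0}\<close> open and the safe set closed. Only a zero
  of \<open>h\<close> in the interior could break the equalities, and \<open>bd\<close> excludes it
  because interior and frontier are disjoint.\<close>

lemma
  assumes cont: "continuous_on UNIV h" and bd: "{x. h x = 0} \<subseteq> frontier (safe_set h)"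
  shows interior_safe_set: "interior (safe_set h) = {x. h x > 0}"
    and frontier_safe_set: "frontier (safe_set h) = {x. h x = 0}"
proof -
  have "open {x. h x > 0}"
    using cont by (intro open_Collect_less) auto
  then have sub: "{x. h x > 0} \<subseteq> interior (safe_set h)"
    by (rule interior_maximal[rotated]) (auto simp: safe_set_def)
  have "interior (safe_set h) \<inter> {x. h x = 0} = {}"
    using bd by (auto simp: frontier_def)
  moreover have "interior (safe_set h) \<subseteq> {x. h x \<ge> 0}"
    using interior_subset[of "safe_set h"] by (simp add: safe_set_def)
  ultimately show int: "interior (safe_set h) = {x. h x > 0}"
    using sub by force
  have "closed (safe_set h)"
    unfolding safe_set_def using cont by (intro closed_Collect_le) auto
  then show "frontier (safe_set h) = {x. h x = 0}"
    unfolding frontier_def int by (auto simp: safe_set_def)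
qed

theorem theorem2:
  fixes f :: "real^'n \<Rightarrow> real^'n" and g :: "real^'n \<Rightarrow> real^'m^'n"
    and V h :: "real^'n \<Rightarrow> real" and \<gamma> \<alpha> :: "real \<Rightarrow> real" and p :: real
  assumes "locally_lipschitz f" and "locally_lipschitz g"
    and "control_lyapunov_function f g \<gamma> V"
    and "control_barrier_function f g \<alpha> h"
    and "0 \<in> interior (safe_set h)"
    and "0 < p"
  shows
    "equilibria f g (qp_control f g V \<gamma> h \<alpha> p) =
       E_clf_nocbf f g V \<gamma> h \<alpha> p {x. h x > 0} \<union>
       E_clf_cbf_1 f g V \<gamma> h \<alpha> p {x. h x = 0} \<union>
       E_clf_cbf_2 f g V \<gamma> h \<alpha> p {x. h x = 0}
     \<and>
     ({x. h x = 0} \<subseteq> frontier (safe_set h) \<longrightarrow>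
       equilibria f g (qp_control f g V \<gamma> h \<alpha> p) =
         E_clf_nocbf f g V \<gamma> h \<alpha> p (interior (safe_set h)) \<union>
         E_clf_cbf_1 f g V \<gamma> h \<alpha> p (frontier (safe_set h)) \<union>
         E_clf_cbf_2 f g V \<gamma> h \<alpha> p (frontier (safe_set h)))"
proof -
  have "smooth h"
    using assms(4) by (simp add: control_barrier_function_def)
  then have "C_k 0 h"
    unfolding smooth_def by blast
  then have cont: "continuous_on UNIV h"
    by simp
  show ?thesis
    using equilibria_qp_control_level_sets[OF assms(6,3,4)]
    by (simp add: interior_safe_set[OF cont] frontier_safe_set[OF cont])
qed

end
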